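(* For all integers $k\ge 0$ and $n\ge k+2$, $$\mathrm{av}_n^k(1324,2413)=\mathrm{av}_n^k(1324)=\sum_{i=0}^k p(i)p(k-i),$$ where $p(i)$ is the number of integer partitions of $i$. In particular, $C_{1324,2413}(x)=P(x)^2$, where $P(x)=\sum_{i\ge 0}p(i)x^i$.
   Context: $\mathrm{av}_n^k(B)$ is the number of permutations in $S_n$ with exactly $k$ inversions (pairs $i<j$ with $\pi_i>\pi_j$) that avoid every pattern in $B$; a permutation avoids a pattern $q$ if it has no subsequence order-isomorphic to $q$. If for every $k\ge0$ there are constants $m_k,c_k(B)$ with $\mathrm{av}_n^k(B)=c_k(B)$ for all $n\ge m_k$, then $(c_k(B))_{k\ge0}$ is the limit sequence of $B$ and $C_B(x)=\sum_{k\ge 0}c_k(B)x^k$ is its limit generating function. *)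

theory Defs
  imports
    "HOL-Combinatorics.Multiset_Permutations"
    "HOL-Library.Sublist"
    "HOL-Computational_Algebra.Formal_Power_Series"
begin

text \<open>
  Permutations and patterns are lists in one-line notation, so that the symmetric group \<open>S\<^sub>n\<close>
  is \<open>permutations_of_set {1..n}\<close>. List positions are counted from \<open>0\<close>.
\<close>

definition inversions :: "nat list \<Rightarrow> (nat \<times> nat) set" where
  "inversions w = {(i, j). i < j \<and> j < length w \<and> w ! i > w ! j}"

definition order_isomorphic :: "nat list \<Rightarrow> nat list \<Rightarrow> bool" where
  "order_isomorphic u v \<longleftrightarrow> length u = length v \<and>
     (\<forall>i<length u. \<forall>j<length u. u ! i < u ! j \<longleftrightarrow> v ! i < v ! j)"

definition avoids :: "nat list \<Rightarrow> nat list \<Rightarrow> bool" where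
  "avoids w q \<longleftrightarrow> \<not> (\<exists>u. subseq u w \<and> order_isomorphic u q)"

definition av :: "nat \<Rightarrow> nat \<Rightarrow> nat list set \<Rightarrow> nat" where
  "av n k B = card {w \<in> permutations_of_set {1..n}.
     card (inversions w) = k \<and> (\<forall>q\<in>B. avoids w q)}"

definition is_limit_sequence :: "nat list set \<Rightarrow> (nat \<Rightarrow> nat) \<Rightarrow> bool" where
  "is_limit_sequence B c \<longleftrightarrow> (\<forall>k. \<exists>m. \<forall>n\<ge>m. av n k B = c k)"

text \<open>
  A limit sequence is unique if it exists; if there is none, \<open>limit_gf B\<close> is unspecified.
\<close>

definition limit_gf :: "nat list set \<Rightarrow> nat fps" where
  "limit_gf B = Abs_fps (THE c. is_limit_sequence B c)"

definition num_partitions :: "nat \<Rightarrow> nat" where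
  "num_partitions i = card {M :: nat multiset. 0 \<notin># M \<and> sum_mset M = i}"

end

theory Submission
  imports Defs
begin

text \<open>
  A permutation of length \<open>n\<close> in which \<open>c\<close> of the gaps between consecutive positions are
  crossed by inversions has at least \<open>c\<close> inversions. Hence a permutation with \<open>k \<le> n - 2\<close>
  inversions is a direct sum of two nonempty permutations. For such a sum \<open>u \<oplus> v\<close>, avoiding 1324
  means that \<open>u\<close> avoids 132 and \<open>v\<close> avoids 213; as 2413 is sum-indecomposable and contains both
  132 and 213, it is then avoided as well. The summands become unique when \<open>u\<close> is required to have
  length \<open>i + 1\<close>, where \<open>i\<close> is its number of inversions. Finally, a permutation avoids 132 iff its
  Lehmer code is weakly decreasing, so 132-avoiders of length greater than \<open>i\<close> with \<open>i\<close> inversions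
  correspond to partitions of \<open>i\<close>, and reverse-complementation carries this over to 213.
\<close>

section \<open>Patterns as inequalities between entries\<close>

lemma order_isomorphic_132_iff:
  "order_isomorphic u [1,3,2] \<longleftrightarrow> (\<exists>x y z. u = [x,y,z] \<and> x < z \<and> z < y)"
  by (auto simp: order_isomorphic_def length_Suc_conv numeral_eq_Suc All_less_Suc less_Suc_eq)

lemma order_isomorphic_213_iff:
  "order_isomorphic u [2,1,3] \<longleftrightarrow> (\<exists>x y z. u = [x,y,z] \<and> y < x \<and> x < z)"
  by (auto simp: order_isomorphic_def length_Suc_conv numeral_eq_Suc All_less_Suc less_Suc_eq)

lemma order_isomorphic_1324_iff:
  "order_isomorphic u [1,3,2,4] \<longleftrightarrow> (\<exists>a b c d. u = [a,b,c,d] \<and> a < c \<and> c < b \<and> b < d)"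
  by (auto simp: order_isomorphic_def length_Suc_conv numeral_eq_Suc All_less_Suc less_Suc_eq)

lemma order_isomorphic_2413_iff:
  "order_isomorphic u [2,4,1,3] \<longleftrightarrow> (\<exists>a b c d. u = [a,b,c,d] \<and> c < a \<and> a < d \<and> d < b)"
  by (auto simp: order_isomorphic_def length_Suc_conv numeral_eq_Suc All_less_Suc less_Suc_eq)

lemma avoids_132_iff:
  "avoids w [1,3,2] \<longleftrightarrow> (\<forall>x y z. subseq [x,y,z] w \<longrightarrow> \<not> (x < z \<and> z < y))"
  unfolding avoids_def order_isomorphic_132_iff by blast

lemma avoids_213_iff:
  "avoids w [2,1,3] \<longleftrightarrow> (\<forall>x y z. subseq [x,y,z] w \<longrightarrow> \<not> (y < x \<and> x < z))"
  unfolding avoids_def order_isomorphic_213_iff by blast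

lemma avoids_1324_iff:
  "avoids w [1,3,2,4] \<longleftrightarrow> (\<forall>a b c d. subseq [a,b,c,d] w \<longrightarrow> \<not> (a < c \<and> c < b \<and> b < d))"
  unfolding avoids_def order_isomorphic_1324_iff by blast

lemma avoids_2413_iff:
  "avoids w [2,4,1,3] \<longleftrightarrow> (\<forall>a b c d. subseq [a,b,c,d] w \<longrightarrow> \<not> (c < a \<and> a < d \<and> d < b))"
  unfolding avoids_def order_isomorphic_2413_iff by blast

lemma avoids_subseq: "avoids w q" if "avoids v q" "subseq w v"
  using that unfolding avoids_def by (meson subseq_order.trans)

section \<open>Counting inversions\<close>

lemma finite_inversions: "finite (inversions w)"
  by (rule finite_subset[of _ "{..<length w} \<times> {..<length w}"]) (auto simp: inversions_def)

lemma inversions_Nil [simp]: "inversions [] = {}"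
  by (auto simp: inversions_def)

text \<open>Inversions that use position 0 correspond to the smaller entries behind
  \<open>x\<close>; all others are inversions of \<open>w\<close> with both positions shifted.
  Inversion counts can thus be computed by induction on the list.\<close>

lemma card_inversions_Cons:
  "card (inversions (x # w)) = length (filter (\<lambda>y. y < x) w) + card (inversions w)"
proof -
  have eq: "inversions (x # w) =
      Pair 0 ` Suc ` {j. j < length w \<and> w ! j < x} \<union> map_prod Suc Suc ` inversions w"
  proof (rule set_eqI)
    fix p :: "nat \<times> nat"
    obtain i j where "p = (i, j)" by fastforce
    then show "p \<in> inversions (x # w) \<longleftrightarrow>
      p \<in> Pair 0 ` Suc ` {j. j < length w \<and> w ! j < x} \<union> map_prod Suc Suc ` inversions w"
      by (cases i; cases j) (auto simp: inversions_def image_iff)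
  qed
  have "card (inversions (x # w)) =
      card (Pair (0::nat) ` Suc ` {j. j < length w \<and> w ! j < x}) +
      card (map_prod Suc Suc ` inversions w)"
    unfolding eq by (rule card_Un_disjoint) (auto simp: finite_inversions)
  also have "card (Pair (0::nat) ` Suc ` {j. j < length w \<and> w ! j < x}) =
      length (filter (\<lambda>y. y < x) w)"
    by (simp add: card_image inj_on_def length_filter_conv_card)
  also have "card (map_prod Suc Suc ` inversions w) = card (inversions w)"
    by (rule card_image) (auto simp: inj_on_def)
  finally show ?thesis .
qed

lemma card_inversions_append:
  assumes "\<forall>x\<in>set u. \<forall>y\<in>set v. x \<le> y"
  shows "card (inversions (u @ v)) = card (inversions u) + card (inversions v)"
  using assms
proof (induction u)
  case (Cons x u)
  then have "filter (\<lambda>y. y < x) v = []"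
    by (auto simp: filter_empty_conv not_less)
  with Cons show ?case by (simp add: card_inversions_Cons)
qed simp

lemma obtain_inversion:
  assumes "card (inversions w) > 0"
  shows "\<exists>x y. subseq [x, y] w \<and> y < x"
  using assms
proof (induction w)
  case (Cons a w)
  show ?case
  proof (cases "filter (\<lambda>y. y < a) w = []")
    case True
    then show ?thesis using Cons
      by (metis add_0 card_inversions_Cons list.size(3) list_emb_Cons)
  next
    case False
    then obtain y where "y \<in> set w" "y < a" by (auto simp: filter_empty_conv)
    then show ?thesis
      by (intro exI[of _ a] exI[of _ y]) (auto simp: subseq_singleton_left)
  qed
qed simp

subsection \<open>Lehmer codes\<close>

primrec lehmer_code :: "nat list \<Rightarrow> nat list" where
  "lehmer_code [] = []"
| "lehmer_code (x # w) = length (filter (\<lambda>y. y < x) w) # lehmer_code w"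

lemma length_lehmer_code [simp]: "length (lehmer_code w) = length w"
  by (induction w) auto

lemma sum_list_lehmer_code: "sum_list (lehmer_code w) = card (inversions w)"
  by (induction w) (auto simp: card_inversions_Cons)

text \<open>Only \<open>length w - i - 1\<close> entries stand behind position \<open>i\<close>.
  This bound characterizes the lists that are codes of permutations, by
  \<open>lehmer_code_surj\<close>.\<close>

lemma lehmer_code_nth_less: "i < length w \<Longrightarrow> lehmer_code w ! i + i < length w"
proof (induction w arbitrary: i)
  case (Cons x w)
  then show ?case by (cases i) (auto simp: le_imp_less_Suc)
qed simp

text \<open>Rewrites the first code entry as the rank of \<open>x\<close> among all entries, which
  depends only on \<open>x\<close> and the set of entries.\<close>

lemma length_filter_less_eq_card:
  fixes x :: nat
  assumes "distinct (x # w)"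
  shows "length (filter (\<lambda>y. y < x) w) = card {y \<in> set (x # w). y < x}"
proof -
  have "length (filter (\<lambda>y. y < x) w) = card (set (filter (\<lambda>y. y < x) w))"
    using assms by (simp add: distinct_card del: set_filter)
  also have "set (filter (\<lambda>y. y < x) w) = {y \<in> set (x # w). y < x}" by auto
  finally show ?thesis .
qed

text \<open>Rank is strictly increasing on \<open>S\<close>: for \<open>a < b\<close> in
  \<open>S\<close>, the element \<open>a\<close> itself is counted for \<open>b\<close> but not for
  \<open>a\<close>.\<close>

lemma card_less_elements_inj:
  fixes x y :: nat
  assumes "finite S" "x \<in> S" "y \<in> S" "card {z \<in> S. z < x} = card {z \<in> S. z < y}"
  shows "x = y"
proof -
  have "card {z \<in> S. z < a} < card {z \<in> S. z < b}" if "a < b" "a \<in> S" for a b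
  proof (rule psubset_card_mono)
    have "a \<notin> {z \<in> S. z < a}" "a \<in> {z \<in> S. z < b}" using that by auto
    moreover have "{z \<in> S. z < a} \<subseteq> {z \<in> S. z < b}" using that by auto
    ultimately show "{z \<in> S. z < a} \<subset> {z \<in> S. z < b}" by blast
  qed (simp add: assms(1))
  from this[of x y] this[of y x] show ?thesis using assms(2-4) by linarith
qed

text \<open>The first code entry is the rank of the head in the common set of entries, so the heads
  agree; removing them leaves lists with equal sets and equal codes.\<close>

lemma lehmer_code_inj:
  assumes "distinct v" "distinct w" "set v = set w" "lehmer_code v = lehmer_code w"
  shows "v = w"
  using assms
proof (induction v arbitrary: w)
  case (Cons x v)
  then obtain y w' where w: "w = y # w'" by (cases w) auto
  have "card {z \<in> set w. z < x} = card {z \<in> set w. z < y}"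
    using length_filter_less_eq_card[OF Cons.prems(1)] length_filter_less_eq_card[of y w']
      Cons.prems(2-4) unfolding w by (metis lehmer_code.simps(2) list.inject)
  then have "x = y"
    using card_less_elements_inj[of "set w" x y] Cons.prems(3) by (auto simp: w)
  moreover from this have "v = w'"
    using Cons.prems by (intro Cons.IH) (auto simp: w)
  ultimately show ?case by (simp add: w)
qed simp

text \<open>Decoding is greedy: the head \<open>m\<close> selects the element of rank
  \<open>m\<close>, and the tail is decoded over what remains. Removing an element from an interval
  need not leave an interval, so \<open>A\<close> is an arbitrary finite set.\<close>

lemma lehmer_code_surj:
  assumes "finite A" "length c = card A" "\<forall>i<length c. c ! i + i < length c"
  shows "\<exists>w\<in>permutations_of_set A. lehmer_code w = c"
  using assms
proof (induction c arbitrary: A)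
  case (Cons m c)
  define xs where "xs = sorted_list_of_set A"
  have xs: "sorted_wrt (<) xs" "set xs = A" "length xs = card A"
    using Cons.prems(1) by (auto simp: xs_def)
  have m: "m < length xs" using Cons.prems(2) Cons.prems(3)[rule_format, of 0] xs(3) by simp
  have lt: "xs ! i < xs ! j \<longleftrightarrow> i < j" if "i < length xs" "j < length xs" for i j
    using sorted_wrt_nth_less[OF xs(1)] that by (metis linorder_neqE_nat not_less_iff_gr_or_eq)
  \<comment> \<open>In the increasing enumeration \<open>xs\<close> of \<open>A\<close>, exactly the
    entries at positions before \<open>m\<close> lie below \<open>xs ! m\<close>, so its rank is
    \<open>m\<close>.\<close>
  have "{y \<in> A. y < xs ! m} = (!) xs ` {..<m}"
  proof (intro equalityI subsetI)
    fix y assume "y \<in> {y \<in> A. y < xs ! m}"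
    then obtain i where "i < length xs" "y = xs ! i" "xs ! i < xs ! m"
      using xs(2) by (auto simp: in_set_conv_nth)
    then show "y \<in> (!) xs ` {..<m}" using lt m by auto
  next
    fix y assume "y \<in> (!) xs ` {..<m}"
    then obtain i where "i < m" "y = xs ! i" by blast
    then show "y \<in> {y \<in> A. y < xs ! m}" using lt[of i m] m xs(2) nth_mem[of i xs] by simp
  qed
  moreover have "inj_on ((!) xs) {..<m}"
    using m lt by (auto simp: inj_on_def) (metis less_trans nat_neq_iff)
  ultimately have card: "card {y \<in> A. y < xs ! m} = m"
    by (simp add: card_image)
  have in_A: "xs ! m \<in> A" using m xs(2) by auto
  have "c ! i + i < length c" if "i < length c" for i
    using Cons.prems(3)[rule_format, of "Suc i"] that by simp
  then obtain w where w: "w \<in> permutations_of_set (A - {xs ! m})" "lehmer_code w = c"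
    using Cons.IH[of "A - {xs ! m}"] Cons.prems(1,2) in_A
    by (metis One_nat_def card_Diff_singleton diff_Suc_1 finite_Diff length_Cons)
  have "xs ! m # w \<in> permutations_of_set A"
    using w in_A by (auto simp: permutations_of_set_def)
  moreover from this have "length (filter (\<lambda>y. y < xs ! m) w) = m"
    using length_filter_less_eq_card[of "xs ! m" w] card
    by (simp add: permutations_of_set_def)
  ultimately show ?case using w(2) by (intro bexI[of _ "xs ! m # w"]) auto
qed simp

section \<open>Avoiding 132 in terms of the code\<close>

text \<open>Both sides fail exactly when some \<open>z\<close> in \<open>w\<close> lies strictly
  between \<open>x\<close> and \<open>y\<close> with \<open>x < y\<close>. Such a \<open>z\<close>
  completes the 132 \<open>x, y, z\<close> and is counted for \<open>y\<close> but not for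
  \<open>x\<close>. Without it, every entry of \<open>w\<close> below \<open>y\<close> is also below
  \<open>x\<close>.\<close>

lemma avoids_132_Cons_iff:
  assumes "distinct (x # y # w)" "avoids (y # w) [1,3,2]"
  shows "avoids (x # y # w) [1,3,2] \<longleftrightarrow>
    length (filter (\<lambda>z. z < y) w) \<le> length (filter (\<lambda>z. z < x) (y # w))"
proof (cases "\<exists>z\<in>set w. x < z \<and> z < y")
  case True
  then obtain z where z: "z \<in> set w" "x < z" "z < y" by blast
  then have "subseq [x, y, z] (x # y # w)" by (simp add: subseq_singleton_left)
  with z have "\<not> avoids (x # y # w) [1,3,2]" unfolding avoids_132_iff by blast
  moreover have "length (filter (\<lambda>z. z < x) (y # w)) < length (filter (\<lambda>z. z < y) w)"
  proof -
    obtain i where i: "i < length w" "w ! i = z" using z(1) by (auto simp: in_set_conv_nth)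
    have "{i. i < length w \<and> w ! i < x} \<subseteq> {i. i < length w \<and> w ! i < y}"
      using z by auto
    moreover have "i \<in> {i. i < length w \<and> w ! i < y} - {i. i < length w \<and> w ! i < x}"
      using i z by auto
    ultimately have "{i. i < length w \<and> w ! i < x} \<subset> {i. i < length w \<and> w ! i < y}"
      by blast
    then have "card {i. i < length w \<and> w ! i < x} < card {i. i < length w \<and> w ! i < y}"
      by (rule psubset_card_mono[rotated]) simp
    then show ?thesis using z by (simp add: length_filter_conv_card)
  qed
  ultimately show ?thesis by simp
next
  case False
  have "avoids (x # y # w) [1,3,2]"
    unfolding avoids_132_iff
  proof (intro allI impI notI)
    fix a b c assume abc: "subseq [a, b, c] (x # y # w)" "a < c \<and> c < b"
    have bc: "\<not> (y < c \<and> subseq [b, c] w)"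
      using assms(2) abc(2) unfolding avoids_132_iff by (metis subseq_Cons2)
    show False
    proof (cases "subseq [a, b, c] (y # w)")
      case True
      then show ?thesis using assms(2) abc(2) unfolding avoids_132_iff by blast
    next
      case not: False
      then have a: "a = x" "subseq [b, c] (y # w)"
        using abc(1) by (auto split: if_splits)
      have c: "c \<in> set w"
        using a(2) by (auto split: if_splits simp: subseq_singleton_left
            dest: subseq_Cons' list_emb_set)
      with False a(1) abc(2) assms(1) have "\<not> c < y" "c \<noteq> y" by auto
      \<comment> \<open>Now \<open>y\<close> can replace \<open>x\<close>: as \<open>b\<close>
        exceeds \<open>c\<close>, it is not \<open>y\<close> either, so \<open>y, b, c\<close> is a
        132 inside \<open>y # w\<close>.\<close>
      then have "y < c" by simp
      moreover from this have "b \<noteq> y" using abc(2) by simp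
      ultimately show ?thesis using bc a(2) by (auto split: if_splits)
    qed
  qed
  moreover have "length (filter (\<lambda>z. z < y) w) \<le> length (filter (\<lambda>z. z < x) (y # w))"
  proof -
    have "filter (\<lambda>z. z < y) w = filter (\<lambda>z. z < y) (filter (\<lambda>z. z < x) w)"
    proof -
      have "z < y \<longleftrightarrow> z < x \<and> z < y" if "z \<in> set w" for z
        using False assms(1) that by (metis distinct.simps(2) linorder_neqE_nat list.set_intros(2))
      then show ?thesis by (auto intro: filter_cong)
    qed
    then have "length (filter (\<lambda>z. z < y) w) \<le> length (filter (\<lambda>z. z < x) w)"
      by (metis length_filter_le)
    then show ?thesis by simp
  qed
  ultimately show ?thesis by simp
qed

text \<open>Each induction step compares the first two code entries; by transitivity of \<ge>,
  comparing neighbours decides whether the whole code is weakly decreasing.\<close>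

lemma avoids_132_iff_code_decreasing:
  assumes "distinct w"
  shows "avoids w [1,3,2] \<longleftrightarrow> sorted_wrt (\<ge>) (lehmer_code w)"
  using assms
proof (induction w)
  case Nil
  then show ?case unfolding avoids_132_iff by simp
next
  case step: (Cons x w)
  show ?case
  proof (cases w)
    case Nil
    then show ?thesis
      unfolding avoids_132_iff by (auto split: if_splits)
  next
    case (Cons y v)
    have "avoids w [1,3,2]" if "avoids (x # w) [1,3,2]"
      using that by (rule avoids_subseq) auto
    moreover have "sorted_wrt (\<ge>) (lehmer_code (x # w)) \<longleftrightarrow>
      length (filter (\<lambda>z. z < y) v) \<le> length (filter (\<lambda>z. z < x) w) \<and>
      sorted_wrt (\<ge>) (lehmer_code w)"
      by (auto simp: Cons)
    moreover have "avoids w [1,3,2] \<Longrightarrow> avoids (x # w) [1,3,2] \<longleftrightarrow>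
      length (filter (\<lambda>z. z < y) v) \<le> length (filter (\<lambda>z. z < x) w)"
      using avoids_132_Cons_iff[of x y v] step.prems unfolding Cons by blast
    moreover have "avoids w [1,3,2] \<longleftrightarrow> sorted_wrt (\<ge>) (lehmer_code w)"
      using step by (metis distinct.simps(2))
    ultimately show ?thesis by blast
  qed
qed

section \<open>Weakly decreasing lists and partitions\<close>

text \<open>Each of the \<open>i\<close> entries in front of position \<open>i\<close> is at least
  \<open>c ! i\<close>, hence at least 1, and so together they contribute at least
  \<open>i\<close>.\<close>

lemma sum_list_decreasing_ge:
  fixes c :: "nat list"
  assumes "sorted_wrt (\<ge>) c" "i < length c" "c ! i > 0"
  shows "c ! i + i \<le> sum_list c"
  using assms
proof (induction c arbitrary: i)
  case (Cons a c)
  show ?case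
  proof (cases i)
    case (Suc j)
    then have "c ! j + j \<le> sum_list c" "c ! j \<le> a" "c ! j > 0" using Cons by auto
    then show ?thesis using Suc by simp
  qed simp
qed simp

text \<open>The bijection \<open>g\<close> sorts the parts decreasingly and pads them with zeros to
  length \<open>n\<close>; deleting the zeros inverts it. A partition of \<open>k\<close> has at
  most \<open>k\<close> parts, so \<open>k \<le> n\<close> leaves enough room.\<close>

lemma card_decreasing_lists:
  assumes "k \<le> n"
  shows "card {c. length c = n \<and> sum_list c = k \<and> sorted_wrt (\<ge>) c} = num_partitions k"
proof -
  define g :: "nat multiset \<Rightarrow> nat list" where
    "g M = rev (sorted_list_of_multiset (M + replicate_mset (n - size M) 0))" for M
  have mset_g: "mset (g M) = M + replicate_mset (n - size M) 0" for M
    by (simp add: g_def)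
  have size: "size M \<le> sum_mset M" if "0 \<notin># M" for M :: "nat multiset"
    using that by (induction M) auto
  have "bij_betw g {M. 0 \<notin># M \<and> sum_mset M = k}
      {c. length c = n \<and> sum_list c = k \<and> sorted_wrt (\<ge>) c}"
    unfolding bij_betw_def
  proof
    show "inj_on g {M. 0 \<notin># M \<and> sum_mset M = k}"
    proof (rule inj_onI)
      fix M N assume "M \<in> {M. 0 \<notin># M \<and> sum_mset M = k}"
        "N \<in> {M. 0 \<notin># M \<and> sum_mset M = k}" and eq: "g M = g N"
      then have "filter_mset (\<lambda>x. x \<noteq> 0) M = M" "filter_mset (\<lambda>x. x \<noteq> 0) N = N"
        by (auto simp: filter_mset_eq_conv intro: gr0I)
      moreover have "filter_mset (\<lambda>x. x \<noteq> 0) (mset (g M)) = filter_mset (\<lambda>x. x \<noteq> 0) M" for M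
        by (simp add: mset_g)
      ultimately show "M = N" using eq by metis
    qed
    show "g ` {M. 0 \<notin># M \<and> sum_mset M = k} =
        {c. length c = n \<and> sum_list c = k \<and> sorted_wrt (\<ge>) c}"
    proof (intro equalityI subsetI)
      fix c assume "c \<in> g ` {M. 0 \<notin># M \<and> sum_mset M = k}"
      then obtain M where M: "0 \<notin># M" "sum_mset M = k" "c = g M" by auto
      have "length c = size (mset c)" by simp
      then have "length c = n" using size[OF M(1)] M assms by (simp add: mset_g)
      moreover have "sum_list c = sum_mset (mset c)" by (simp add: sum_mset_sum_list)
      then have "sum_list c = k" using M by (simp add: mset_g)
      moreover have "sorted_wrt (\<ge>) c"
        by (simp add: M g_def sorted_wrt_rev)
      ultimately show "c \<in> {c. length c = n \<and> sum_list c = k \<and> sorted_wrt (\<ge>) c}" by simp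
    next
      fix c :: "nat list"
      assume "c \<in> {c. length c = n \<and> sum_list c = k \<and> sorted_wrt (\<ge>) c}"
      then have c: "length c = n" "sum_list c = k" "sorted_wrt (\<ge>) c" by auto
      define M where "M = filter_mset (\<lambda>x. x \<noteq> 0) (mset c)"
      have zeros: "filter_mset (\<lambda>x. x = 0) (mset c) = replicate_mset (count (mset c) 0) 0"
        using filter_eq_replicate_mset[of 0 "mset c"] by (simp add: eq_commute)
      have split: "mset c = M + replicate_mset (count (mset c) 0) 0"
        using multiset_partition[of "mset c" "\<lambda>x. x \<noteq> 0"] zeros by (simp add: M_def)
      have "n = size M + count (mset c) 0"
        using arg_cong[OF split, of size] c(1) by simp
      then have "mset c = M + replicate_mset (n - size M) 0" using split by simp
      moreover have "sorted (rev c)" using c(3) by (simp add: sorted_wrt_rev)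
      ultimately have "g M = c"
        unfolding g_def by (metis mset_rev rev_rev_ident sorted_list_of_multiset_mset sorted_sort_id)
      moreover have "sum_mset M = k"
        using arg_cong[OF split, of sum_mset] c(2) by (simp add: sum_mset_sum_list)
      moreover have "0 \<notin># M" by (simp add: M_def)
      ultimately show "c \<in> g ` {M. 0 \<notin># M \<and> sum_mset M = k}" by blast
    qed
  qed
  from bij_betw_same_card[OF this] show ?thesis unfolding num_partitions_def by (rule sym)
qed

lemma card_avoiding_132:
  assumes "finite A" "k < card A"
  shows "card {w \<in> permutations_of_set A. card (inversions w) = k \<and> avoids w [1,3,2]} =
    num_partitions k"
proof -
  have "bij_betw lehmer_code
      {w \<in> permutations_of_set A. card (inversions w) = k \<and> avoids w [1,3,2]}
      {c. length c = card A \<and> sum_list c = k \<and> sorted_wrt (\<ge>) c}"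
    unfolding bij_betw_def
  proof
    show "inj_on lehmer_code
        {w \<in> permutations_of_set A. card (inversions w) = k \<and> avoids w [1,3,2]}"
      by (rule inj_onI, rule lehmer_code_inj) (simp_all add: permutations_of_set_def)
    \<comment> \<open>This makes every weakly decreasing list of the right length and sum a Lehmer
      code. It is immediate for a zero entry; for a positive one, \<open>c ! i + i\<close> is at
      most \<open>k\<close>, which is less than \<open>card A\<close>.\<close>
    have bound: "c ! i + i < length c"
      if "length c = card A" "sum_list c = k" "sorted_wrt (\<ge>) c" "i < length c" for c i
      using sum_list_decreasing_ge[OF that(3,4)] that(1,2,4) assms(2) by (cases "c ! i = 0") simp_all
    have crit: "card (inversions w) = k \<and> avoids w [1,3,2] \<longleftrightarrow>
        sum_list (lehmer_code w) = k \<and> sorted_wrt (\<ge>) (lehmer_code w)"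
      if "w \<in> permutations_of_set A" for w
      using that avoids_132_iff_code_decreasing[of w]
      by (simp add: sum_list_lehmer_code permutations_of_set_def)
    show "lehmer_code `
        {w \<in> permutations_of_set A. card (inversions w) = k \<and> avoids w [1,3,2]} =
        {c. length c = card A \<and> sum_list c = k \<and> sorted_wrt (\<ge>) c}" (is "_ ` ?L = ?R")
    proof (intro equalityI subsetI)
      fix c assume "c \<in> lehmer_code ` ?L"
      then show "c \<in> ?R" using crit by (auto simp: length_finite_permutations_of_set)
    next
      fix c assume c: "c \<in> ?R"
      then obtain w where "w \<in> permutations_of_set A" "lehmer_code w = c"
        using lehmer_code_surj[OF assms(1), of c] bound by auto
      then show "c \<in> lehmer_code ` ?L" using crit c by blast
    qed
  qed
  from bij_betw_same_card[OF this] show ?thesis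
    using card_decreasing_lists[of k "card A"] assms(2) by simp
qed

subsection \<open>Reverse-complements\<close>

lemma card_inversions_snoc:
  "card (inversions (w @ [a])) = card (inversions w) + length (filter (\<lambda>y. a < y) w)"
  by (induction w) (simp_all add: card_inversions_Cons)

text \<open>Reversing the positions and reversing the order of the values each exchange inversions
  with non-inversions, so doing both preserves their number.\<close>

lemma card_inversions_map_rev:
  assumes "\<And>x y. x \<in> set w \<Longrightarrow> y \<in> set w \<Longrightarrow> f y < f x \<longleftrightarrow> x < y"
  shows "card (inversions (map f (rev w))) = card (inversions w)"
  using assms
proof (induction w)
  case (Cons x w)
  have "filter (\<lambda>y. f x < f y) (rev w) = filter (\<lambda>y. y < x) (rev w)"
    using Cons.prems by (intro filter_cong) auto
  then have "length (filter (\<lambda>y. f x < y) (map f (rev w))) = length (filter (\<lambda>y. y < x) w)"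
    by (simp add: filter_map comp_def flip: rev_filter)
  then show ?case using Cons by (simp add: card_inversions_snoc card_inversions_Cons)
qed simp

lemma subseq_rev:
  assumes "subseq u w"
  shows "subseq (rev u) (rev w)"
proof -
  have "subseq u w \<Longrightarrow> subseq (rev u) (rev w)"
  proof (induction rule: list_emb.induct)
    case (list_emb_Cons xs ys y)
    then show ?case by (simp add: subseq_rev_drop_many)
  next
    case (list_emb_Cons2 x y xs ys)
    then show ?case by (simp add: list_emb_append_mono)
  qed simp
  with assms show ?thesis by blast
qed

lemma set_subset_of_subseq: "subseq u w \<Longrightarrow> set u \<subseteq> set w"
  unfolding subseq_conv_nths using set_nths_subset by fastforce

text \<open>The reverse of 213 is 312, whose complement is 132. As \<open>f\<close> is an involution
  on the entries, occurrences can be carried in both directions.\<close>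

lemma avoids_map_rev_iff:
  assumes mem: "\<And>x. x \<in> set w \<Longrightarrow> f (f x) = x"
    and anti: "\<And>x y. x \<in> set w \<Longrightarrow> y \<in> set w \<Longrightarrow> f y < f x \<longleftrightarrow> x < y"
  shows "avoids (map f (rev w)) [1,3,2] \<longleftrightarrow> avoids w [2,1,3]"
  unfolding avoids_132_iff avoids_213_iff
proof (intro iffI allI impI notI)
  fix x y z
  assume *: "\<forall>x y z. subseq [x,y,z] (map f (rev w)) \<longrightarrow> \<not> (x < z \<and> z < y)"
    and sub: "subseq [x,y,z] w" and less: "y < x \<and> x < z"
  have "{x, y, z} \<subseteq> set w" using set_subset_of_subseq[OF sub] by simp
  then have "f z < f x" "f x < f y" using less anti by auto
  moreover have "subseq [f z, f y, f x] (map f (rev w))"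
    using subseq_map[OF subseq_rev[OF sub], of f] by simp
  ultimately show False using * by blast
next
  fix x y z
  assume *: "\<forall>x y z. subseq [x,y,z] w \<longrightarrow> \<not> (y < x \<and> x < z)"
    and sub: "subseq [x,y,z] (map f (rev w))" and less: "x < z \<and> z < y"
  have "rev (map f (map f (rev w))) = w"
    using mem by (simp add: rev_map map_idI)
  then have fsub: "subseq [f z, f y, f x] w"
    using subseq_rev[OF subseq_map[OF sub, of f]] by simp
  have "{x, y, z} \<subseteq> f ` set w" using set_subset_of_subseq[OF sub] by simp
  then have "f y < f z" "f z < f x" using less anti mem by auto
  with fsub * show False by blast
qed

text \<open>The assumption says that \<open>{a..b}\<close> has more than \<open>k\<close> elements,
  as the count for 132 requires. The map \<open>f\<close> is the complement within
  \<open>{a..b}\<close>, so \<open>h\<close> is the reverse-complement and its own inverse.\<close>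

lemma card_avoiding_213:
  assumes "k + a < Suc b"
  shows "card {w \<in> permutations_of_set {a..b}. card (inversions w) = k \<and> avoids w [2,1,3]} =
    num_partitions k" (is "card ?L = _")
proof -
  define f where "f x = a + b - x" for x :: nat
  define h where "h w = map f (rev w)" for w
  have perm: "h w \<in> permutations_of_set {a..b}" "h (h w) = w"
    "card (inversions (h w)) = card (inversions w)"
    "avoids (h w) [1,3,2] \<longleftrightarrow> avoids w [2,1,3]"
    if "w \<in> permutations_of_set {a..b}" for w
  proof -
    have w: "set w = {a..b}" "distinct w" using that by (auto simp: permutations_of_set_def)
    have f_f: "f (f x) = x" if "x \<in> set w" for x using that w(1) by (auto simp: f_def)
    have anti: "f y < f x \<longleftrightarrow> x < y" if "x \<in> set w" "y \<in> set w" for x y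
      using that w(1) by (auto simp: f_def)
    have "f ` {a..b} = {a..b}"
    proof (intro equalityI subsetI)
      fix x assume "x \<in> {a..b}"
      moreover have "f x \<in> {a..b}" using \<open>x \<in> {a..b}\<close> by (auto simp: f_def)
      ultimately show "x \<in> f ` {a..b}" using f_f w(1) by (metis imageI)
    qed (auto simp: f_def)
    moreover have "inj_on f {a..b}" using f_f w(1) by (metis inj_onI)
    ultimately show "h w \<in> permutations_of_set {a..b}"
      using w by (simp add: h_def permutations_of_set_def distinct_map)
    show "h (h w) = w" using f_f by (simp add: h_def rev_map map_idI)
    show "card (inversions (h w)) = card (inversions w)"
      unfolding h_def using anti by (rule card_inversions_map_rev)
    show "avoids (h w) [1,3,2] \<longleftrightarrow> avoids w [2,1,3]"
      unfolding h_def using f_f anti by (rule avoids_map_rev_iff)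
  qed
  let ?R = "{w \<in> permutations_of_set {a..b}. card (inversions w) = k \<and> avoids w [1,3,2]}"
  have "bij_betw h ?L ?R"
  proof (rule bij_betw_byWitness[where f' = h])
    show "\<forall>w\<in>?L. h (h w) = w" "\<forall>w\<in>?R. h (h w) = w" using perm(2) by blast+
    show "h ` ?L \<subseteq> ?R" using perm by auto
    show "h ` ?R \<subseteq> ?L"
    proof (intro image_subsetI CollectI conjI)
      fix w assume w: "w \<in> ?R"
      then show h: "h w \<in> permutations_of_set {a..b}" "card (inversions (h w)) = k"
        using perm by auto
      have "avoids (h (h w)) [1,3,2]" using w perm(2) by auto
      with perm(4)[OF h(1)] show "avoids (h w) [2,1,3]" by blast
    qed
  qed
  from bij_betw_same_card[OF this] show ?thesis
    using card_avoiding_132[of "{a..b}" k] assms by simp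
qed

subsection \<open>Cuts\<close>

text \<open>For a permutation, a cut strictly between \<open>0\<close> and \<open>length w\<close>
  is a decomposition into a direct sum of nonempty parts. All \<open>c \<ge> length w\<close> are
  cuts too, which keeps the set of non-cuts finite.\<close>

definition cut :: "nat list \<Rightarrow> nat \<Rightarrow> bool" where
  "cut w c \<longleftrightarrow> (\<forall>x\<in>set (take c w). \<forall>y\<in>set (drop c w). x \<le> y)"

lemma cut_0: "cut w 0"
  by (simp add: cut_def)

lemma cut_length: "length w \<le> c \<Longrightarrow> cut w c"
  by (simp add: cut_def)

lemma finite_not_cut: "finite {c. \<not> cut w c}"
  by (rule finite_subset[of _ "{..<length w}"]) (auto intro: cut_length simp: not_less[symmetric])

lemma cut_Suc_Cons: "cut (x # w) (Suc c) \<longleftrightarrow> (\<forall>y\<in>set (drop c w). x \<le> y) \<and> cut w c"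
  by (auto simp: cut_def)

lemma card_inversions_cut:
  "cut w c \<Longrightarrow> card (inversions w) = card (inversions (take c w)) + card (inversions (drop c w))"
  using card_inversions_append[of "take c w" "drop c w"] by (simp add: cut_def)

text \<open>If \<open>c\<close> is a cut of \<open>w\<close> but \<open>Suc c\<close> is not one of \<open>x # w\<close>, then some entry behind \<open>c\<close> is
  smaller than \<open>x\<close>, hence so are all \<open>c\<close> entries in front of it. So the number of such \<open>c\<close> is at
  most the number of inversions that \<open>x\<close> contributes.\<close>

lemma card_not_cut_le: "card {c. \<not> cut w c} \<le> card (inversions w)"
proof (induction w)
  case Nil
  then show ?case by (simp add: cut_def)
next
  case (Cons x w)
  let ?r = "length (filter (\<lambda>y. y < x) w)"
  have "{c. \<not> cut (x # w) c} \<subseteq> Suc ` ({c. \<not> cut w c} \<union> {..<?r})"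
  proof
    fix c assume "c \<in> {c. \<not> cut (x # w) c}"
    then obtain d where d: "c = Suc d" "\<not> cut (x # w) (Suc d)"
      using cut_0 by (cases c) auto
    have "d < ?r" if cut: "cut w d"
    proof -
      obtain y where y: "y \<in> set (drop d w)" "y < x"
        using d(2) cut by (auto simp: cut_Suc_Cons not_le)
      then have "filter (\<lambda>y. y < x) (take d w) = take d w"
        using cut by (fastforce simp: cut_def filter_id_conv)
      moreover have "filter (\<lambda>y. y < x) (drop d w) \<noteq> []"
        using y by (auto simp: filter_empty_conv)
      moreover have "d < length w" using y(1) by (cases "d < length w") auto
      moreover have "?r = length (filter (\<lambda>y. y < x) (take d w)) +
          length (filter (\<lambda>y. y < x) (drop d w))"
        by (metis append_take_drop_id filter_append length_append)
      ultimately show ?thesis by simp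
    qed
    then show "c \<in> Suc ` ({c. \<not> cut w c} \<union> {..<?r})" using d(1) by blast
  qed
  then have "card {c. \<not> cut (x # w) c} \<le> card (Suc ` ({c. \<not> cut w c} \<union> {..<?r}))"
    by (rule card_mono[rotated]) (simp add: finite_not_cut)
  also have "\<dots> = card ({c. \<not> cut w c} \<union> {..<?r})"
    by (rule card_image) simp
  also have "\<dots> \<le> card {c. \<not> cut w c} + ?r"
    using card_Un_le[of "{c. \<not> cut w c}" "{..<?r}"] by simp
  also have "\<dots> \<le> card (inversions (x # w))"
    using Cons.IH by (simp add: card_inversions_Cons)
  finally show ?case .
qed

text \<open>All \<open>length w - 1\<close> inner positions are non-cuts, and each of them costs an
  inversion. The contrapositive supplies a cut when inversions are few.\<close>

lemma length_le_of_no_cut: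
  assumes "\<And>c. 0 < c \<Longrightarrow> c < length w \<Longrightarrow> \<not> cut w c"
  shows "length w \<le> Suc (card (inversions w))"
proof -
  have "card {0<..<length w} \<le> card {c. \<not> cut w c}"
    using assms by (intro card_mono finite_not_cut) auto
  with card_not_cut_le[of w] show ?thesis by simp
qed

text \<open>Having few inversions forces an inner cut, and an entry \<open>z\<close> behind it
  exceeds \<open>x\<close>. An entry \<open>y\<close> below \<open>x\<close> would have to stand
  before the cut, giving the 213 \<open>x, y, z\<close>.\<close>

lemma hd_le_of_avoids_213:
  assumes "distinct (x # v)" "avoids (x # v) [2,1,3]" "card (inversions (x # v)) < length v"
  shows "\<forall>y\<in>set v. x \<le> y"
proof
  fix y assume y: "y \<in> set v"
  obtain c where "0 < c" "c < length (x # v)" "cut (x # v) c"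
    using length_le_of_no_cut[of "x # v"] assms(3) by fastforce
  then obtain d where d: "d < length v" "\<forall>y\<in>set (drop d v). x \<le> y" "cut v d"
    by (cases c) (auto simp: cut_Suc_Cons)
  define z where "z = v ! d"
  have z: "z \<in> set (drop d v)" using d(1) by (simp add: z_def flip: Cons_nth_drop_Suc)
  moreover from this have "z \<in> set v" by (rule in_set_dropD)
  ultimately have "x < z" using d(2) assms(1) by (metis distinct.simps(2) le_neq_implies_less)
  show "x \<le> y"
  proof (rule ccontr)
    assume "\<not> x \<le> y"
    then have "y \<notin> set (drop d v)" "y < x" using d(2) by auto
    then have "y \<in> set (take d v)" using y by (metis Un_iff append_take_drop_id set_append)
    then have "subseq ([y] @ [z]) (take d v @ drop d v)"
      using z by (intro list_emb_append_mono) (simp_all only: subseq_singleton_left)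
    then have "subseq [x, y, z] (x # v)" by simp
    with assms(2) \<open>y < x\<close> \<open>x < z\<close> show False unfolding avoids_213_iff by blast
  qed
qed

text \<open>The head is minimal and contributes no inversion, so removing it lowers the excess of
  length over inversions by exactly one. This can be repeated \<open>t\<close> times.\<close>

lemma cut_of_avoids_213:
  assumes "distinct v" "avoids v [2,1,3]" "card (inversions v) + t < length v"
  shows "cut v t \<and> card (inversions (take t v)) = 0"
  using assms
proof (induction t arbitrary: v)
  case 0
  then show ?case by (simp add: cut_0)
next
  case (Suc t)
  then obtain x u where v: "v = x # u" by (cases v) auto
  have min: "\<forall>y\<in>set u. x \<le> y"
    using hd_le_of_avoids_213[of x u] Suc.prems unfolding v by simp
  then have nofilter: "filter (\<lambda>y. y < x) u' = []" if "set u' \<subseteq> set u" for u'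
    using that by (auto simp: filter_empty_conv not_less)
  have "avoids u [2,1,3]"
    using Suc.prems(2) by (rule avoids_subseq) (auto simp: v)
  moreover have "card (inversions u) + t < length u"
    using Suc.prems(3) nofilter[of u] by (simp add: v card_inversions_Cons)
  ultimately have "cut u t \<and> card (inversions (take t u)) = 0"
    using Suc.prems(1) by (intro Suc.IH) (auto simp: v)
  then show ?case
    using min nofilter[of "take t u"] set_take_subset[of t u] set_drop_subset[of t u]
    by (auto simp: v cut_Suc_Cons card_inversions_Cons)
qed

subsection \<open>Splitting 1324-avoiders\<close>

text \<open>The splits that put at most one entry into \<open>u\<close> are merged, since both leave
  the last three entries in \<open>v\<close>.\<close>

lemma subseq4_append_cases:
  assumes "subseq [a,b,c,d] (u @ v)"
  shows "subseq [b,c,d] v \<or> (subseq [a,b] u \<and> subseq [c,d] v) \<or>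
    (subseq [a,b,c] u \<and> d \<in> set v) \<or> subseq [a,b,c,d] u"
  using assms
  by (auto simp: subseq_append_iff Cons_eq_append_conv subseq_singleton_left dest: subseq_Cons')

text \<open>A 132 in \<open>u\<close> extends by \<open>hd v\<close> to a 1324, and a 213 in
  \<open>v\<close> by \<open>hd u\<close>. Conversely, an occurrence of 1324 split two and two would
  put its 3 into \<open>u\<close> and its 2 into \<open>v\<close>, against the order of the
  summands; every other split leaves a 132 in \<open>u\<close> or a 213 in \<open>v\<close>.\<close>

lemma avoids_1324_append_iff:
  assumes "\<forall>x\<in>set u. \<forall>y\<in>set v. x < y" "u \<noteq> []" "v \<noteq> []"
  shows "avoids (u @ v) [1,3,2,4] \<longleftrightarrow> avoids u [1,3,2] \<and> avoids v [2,1,3]"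
proof
  assume av: "avoids (u @ v) [1,3,2,4]"
  show "avoids u [1,3,2] \<and> avoids v [2,1,3]"
  proof
    show "avoids u [1,3,2]"
      unfolding avoids_132_iff
    proof (intro allI impI notI)
      fix x y z assume sub: "subseq [x,y,z] u" and less: "x < z \<and> z < y"
      have "y \<in> set u" using set_subset_of_subseq[OF sub] by simp
      with assms have "y < hd v" by simp
      moreover have "subseq ([x,y,z] @ [hd v]) (u @ v)"
        using sub assms(3) by (intro list_emb_append_mono) (simp_all add: subseq_singleton_left)
      ultimately show False using av less unfolding avoids_1324_iff by auto
    qed
    show "avoids v [2,1,3]"
      unfolding avoids_213_iff
    proof (intro allI impI notI)
      fix x y z assume sub: "subseq [x,y,z] v" and less: "y < x \<and> x < z"
      have "y \<in> set v" using set_subset_of_subseq[OF sub] by simp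
      with assms have "hd u < y" by simp
      moreover have "subseq ([hd u] @ [x,y,z]) (u @ v)"
        using sub assms(2) by (intro list_emb_append_mono) (simp_all add: subseq_singleton_left)
      ultimately show False using av less unfolding avoids_1324_iff by auto
    qed
  qed
next
  assume av: "avoids u [1,3,2] \<and> avoids v [2,1,3]"
  show "avoids (u @ v) [1,3,2,4]"
    unfolding avoids_1324_iff
  proof (intro allI impI notI)
    fix a b c d assume sub: "subseq [a,b,c,d] (u @ v)" and less: "a < c \<and> c < b \<and> b < d"
    have "\<not> subseq [b,c,d] v" using av less unfolding avoids_213_iff by blast
    moreover have not_u: "\<not> subseq [a,b,c] u" using av less unfolding avoids_132_iff by blast
    moreover have "\<not> (subseq [a,b] u \<and> subseq [c,d] v)"
      using assms(1) less set_subset_of_subseq[of "[a,b]" u] set_subset_of_subseq[of "[c,d]" v]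
      by fastforce
    moreover have "\<not> subseq [a,b,c,d] u"
      using not_u subseq_order.trans[of "[a,b,c]" "[a,b,c,d]" u] by auto
    ultimately show False using subseq4_append_cases[OF sub] by blast
  qed
qed

lemma avoids_2413_append:
  assumes "\<forall>x\<in>set u. \<forall>y\<in>set v. x < y" "avoids u [1,3,2]" "avoids v [2,1,3]"
  shows "avoids (u @ v) [2,4,1,3]"
  unfolding avoids_2413_iff
proof (intro allI impI notI)
  fix a b c d assume sub: "subseq [a,b,c,d] (u @ v)" and less: "c < a \<and> a < d \<and> d < b"
  have "\<not> subseq [a,b,d] u" using assms(2) less unfolding avoids_132_iff by blast
  then have not_u: "\<not> subseq [a,b,c,d] u"
    using subseq_order.trans[of "[a,b,d]" "[a,b,c,d]" u] less by auto
  have "\<not> subseq [a,c,d] v" using assms(3) less unfolding avoids_213_iff by blast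
  then have not_v: "\<not> subseq [a,b,c,d] v"
    using subseq_order.trans[of "[a,c,d]" "[a,b,c,d]" v] less by auto
  obtain p q where pq: "[a,b,c,d] = p @ q" "subseq p u" "subseq q v"
    using sub by (auto simp: subseq_append_iff)
  then have mem: "set p \<subseteq> set u" "set q \<subseteq> set v" by (auto dest: set_subset_of_subseq)
  have "p \<noteq> []" "q \<noteq> []" using pq not_u not_v by auto
  \<comment> \<open>If \<open>p\<close> has one or two entries, it contains \<open>a\<close> while
    \<open>q\<close> contains \<open>c\<close>; if it has three, they are separated as
    \<open>b\<close> and \<open>d\<close>. Either way a larger value lies in \<open>u\<close> and a
    smaller one in \<open>v\<close>.\<close>
  then consider "a \<in> set u" "c \<in> set v" | "b \<in> set u" "d \<in> set v"
    using pq(1) mem by (auto simp: Cons_eq_append_conv)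
  then show False using assms(1) less by cases fastforce+
qed

text \<open>The set \<open>X\<close> is closed downwards in \<open>{1..n}\<close>, so each
  \<open>x\<close> in \<open>X\<close> comes with all of \<open>{1..x}\<close> and is at most
  \<open>card X\<close>.\<close>

lemma initial_segment_of_split:
  fixes n :: nat
  assumes "X \<union> Y = {1..n}" "\<forall>x\<in>X. \<forall>y\<in>Y. x < y"
  shows "X = {1..card X}"
proof -
  have fin: "finite X" using assms(1) by (metis finite_Un finite_atLeastAtMost)
  have "X \<subseteq> {1..card X}"
  proof
    fix x assume x: "x \<in> X"
    have "{1..x} \<subseteq> X"
    proof
      fix z assume z: "z \<in> {1..x}"
      have "x \<le> n" using x assms(1) by (metis UnI1 atLeastAtMost_iff)
      with z have "z \<in> X \<union> Y" using assms(1) by simp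
      moreover have "z \<notin> Y" using assms(2) x z by fastforce
      ultimately show "z \<in> X" by blast
    qed
    then have "card {1..x} \<le> card X" using fin by (rule card_mono[rotated])
    moreover have "1 \<le> x" using x assms(1) by (metis UnI1 atLeastAtMost_iff)
    ultimately show "x \<in> {1..card X}" by simp
  qed
  then show ?thesis by (simp add: card_subset_eq)
qed

lemma split_permutation:
  assumes "u @ v \<in> permutations_of_set {1..n}" "\<forall>x\<in>set u. \<forall>y\<in>set v. x < y"
  shows "u \<in> permutations_of_set {1..length u}" "v \<in> permutations_of_set {length u + 1..n}"
proof -
  have uv: "set u \<union> set v = {1..n}" "distinct u" "distinct v" "set u \<inter> set v = {}"
    using assms(1) by (auto simp: permutations_of_set_def)
  then have u: "set u = {1..length u}"
    using initial_segment_of_split[OF uv(1) assms(2)] by (simp add: distinct_card)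
  have "set v = {1..n} - {1..length u}" using uv u by auto
  also have "\<dots> = {length u + 1..n}" by auto
  finally show "u \<in> permutations_of_set {1..length u}"
    "v \<in> permutations_of_set {length u + 1..n}"
    using u uv by (auto simp: permutations_of_set_def)
qed

text \<open>Cutting at the first possible place gives a prefix \<open>u\<close> of length at most
  one more than its number of inversions. Entries are then moved from \<open>v\<close> to
  \<open>u\<close>, without creating inversions, until equality holds.\<close>

lemma split_1324_avoider:
  assumes w: "w \<in> permutations_of_set {1..n}" "avoids w [1,3,2,4]"
    and inv: "card (inversions w) + 2 \<le> n"
  obtains u v where "w = u @ v" "v \<noteq> []" "\<forall>x\<in>set u. \<forall>y\<in>set v. x < y"
    "length u = Suc (card (inversions u))"
proof -
  have len: "length w = n" and dist: "distinct w"
    using w(1) by (auto simp: permutations_of_set_def dest: distinct_card)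
  have strict: "\<forall>x\<in>set (take c w). \<forall>y\<in>set (drop c w). x < y" if "cut w c" for c
  proof (intro ballI)
    fix x y assume "x \<in> set (take c w)" "y \<in> set (drop c w)"
    moreover have "set (take c w) \<inter> set (drop c w) = {}"
      using dist by (rule set_take_disj_set_drop_if_distinct) simp
    ultimately show "x < y" using that unfolding cut_def by (metis disjoint_iff le_neq_implies_less)
  qed
  \<comment> \<open>Minimality of \<open>c\<close> means that the prefix \<open>take c w\<close> has
    no inner cut, which bounds its length.\<close>
  define c where "c = (LEAST c. 0 < c \<and> cut w c)"
  obtain c' where c': "0 < c'" "c' < length w" "cut w c'"
    using length_le_of_no_cut[of w] inv len by fastforce
  then have c: "0 < c" "cut w c"
    using LeastI[of "\<lambda>c. 0 < c \<and> cut w c" c'] unfolding c_def by blast+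
  have c_least: "c \<le> d" if "0 < d" "cut w d" for d
    using that unfolding c_def by (simp add: Least_le)
  have "c < n" using c_least[of c'] c' len by simp
  define u v where "u = take c w" and "v = drop c w"
  have uv: "w = u @ v" "length u = c" "u \<noteq> []" "v \<noteq> []"
    using c(1) \<open>c < n\<close> len by (auto simp: u_def v_def)
  have "\<not> cut u d" if d: "0 < d" "d < length u" for d
  proof
    assume cut: "cut u d"
    have eqs: "take d w = take d u" "drop d w = drop d u @ v"
      using d uv by auto
    have "\<forall>x\<in>set (take d u). \<forall>y\<in>set v. x \<le> y"
      using c(2) set_take_subset[of d u] unfolding cut_def u_def v_def by blast
    with cut have "cut w d" unfolding cut_def eqs set_append ball_Un by blast
    then show False using c_least[of d] d uv by simp
  qed
  then have len_u: "length u \<le> Suc (card (inversions u))"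
    by (rule length_le_of_no_cut)
  have sum: "card (inversions w) = card (inversions u) + card (inversions v)"
    using card_inversions_cut[OF c(2)] by (simp add: u_def v_def)
  have less_uv: "\<forall>x\<in>set u. \<forall>y\<in>set v. x < y" using strict[OF c(2)] by (simp add: u_def v_def)
  have "avoids v [2,1,3]"
    using w(2) uv(1) avoids_1324_append_iff[OF less_uv uv(3,4)] by blast
  \<comment> \<open>The number of entries still missing from \<open>u\<close>. With
    \<open>card (inversions w) + 2 \<le> n\<close>, the remainder \<open>v\<close> is long enough to
    supply them and stay nonempty.\<close>
  define t where "t = Suc (card (inversions u)) - length u"
  have t: "length u + t = Suc (card (inversions u))" using len_u by (simp add: t_def)
  have len_uv: "length u + length v = n" using uv(1) len by (metis length_append)
  have "card (inversions v) + t < length v" using t sum inv len_uv by linarith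
  then have t_cut: "cut v t" "card (inversions (take t v)) = 0" and "t < length v"
    using cut_of_avoids_213[of v t] \<open>avoids v [2,1,3]\<close> dist by (auto simp: v_def)
  show thesis
  proof
    show "w = (u @ take t v) @ drop t v" using uv(1) by simp
    show "drop t v \<noteq> []" using \<open>t < length v\<close> by simp
    have "cut w (c + t)"
      unfolding cut_def
    proof (intro ballI)
      fix x y assume xy: "x \<in> set (take (c + t) w)" "y \<in> set (drop (c + t) w)"
      have "take (c + t) w = u @ take t v" "drop (c + t) w = drop t v" using uv by auto
      with xy have "x \<in> set u \<or> x \<in> set (take t v)" "y \<in> set (drop t v)" by auto
      then show "x \<le> y"
        using less_uv t_cut(1) set_drop_subset[of t v] unfolding cut_def
        by (metis less_imp_le subsetD)
    qed
    then show "\<forall>x\<in>set (u @ take t v). \<forall>y\<in>set (drop t v). x < y"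
      using strict[of "c + t"] uv by simp
    \<comment> \<open>The moved entries contain no inversion and all exceed those of
      \<open>u\<close>.\<close>
    have "card (inversions (u @ take t v)) = card (inversions u)"
      using t_cut(2) less_uv set_take_subset[of t v]
      by (subst card_inversions_append) (auto intro: less_imp_le)
    then show "length (u @ take t v) = Suc (card (inversions (u @ take t v)))"
      using t \<open>t < length v\<close> by simp
  qed
qed

text \<open>A longer prefix contains more inversions, and one that is not in \<open>u\<close> lies behind \<open>u\<close>, so it
  forms a 132 with the first entry of \<open>u\<close>.\<close>

lemma not_avoids_132_of_longer_prefix:
  assumes "u @ v = u' @ v'" "length u < length u'"
    and "\<forall>x\<in>set u. \<forall>y\<in>set v. x < y" "u \<noteq> []"
    and "card (inversions u) < card (inversions u')"
  shows "\<not> avoids u' [1,3,2]"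
proof -
  obtain r where r: "u' = u @ r" "v = r @ v'"
    using assms(1,2) by (auto simp: append_eq_append_conv2)
  have less: "\<forall>x\<in>set u. \<forall>y\<in>set r. x < y" using assms(3) r(2) by auto
  then have "card (inversions u') = card (inversions u) + card (inversions r)"
    unfolding r(1) by (intro card_inversions_append) (auto intro: less_imp_le)
  with assms(5) obtain x y where xy: "subseq [x, y] r" "y < x"
    using obtain_inversion[of r] by auto
  have "subseq ([hd u] @ [x, y]) (u @ r)"
    using xy(1) assms(4) by (intro list_emb_append_mono) (simp_all add: subseq_singleton_left)
  moreover have "hd u < y"
    using less assms(4) set_subset_of_subseq[OF xy(1)] by simp
  ultimately show ?thesis
    using xy(2) unfolding r(1) avoids_132_iff by auto
qed

section \<open>Counting 1324-avoiders\<close>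

lemma append_in_permutations_of_set:
  assumes "u \<in> permutations_of_set A" "v \<in> permutations_of_set B" "A \<inter> B = {}"
  shows "u @ v \<in> permutations_of_set (A \<union> B)"
  using assms by (auto simp: permutations_of_set_def)

text \<open>The summation index \<open>i\<close> is the number of inversions of the first summand.
  As that summand has length \<open>i + 1\<close>, the sets of values of both summands are
  determined by \<open>i\<close>, and the words can be counted as pairs from \<open>A i\<close> and
  \<open>B i\<close>.\<close>

lemma card_avoiding_1324:
  assumes "k + 2 \<le> n"
  shows "av n k {[1,3,2,4]} = (\<Sum>i=0..k. num_partitions i * num_partitions (k - i))"
proof -
  define S where
    "S = {w \<in> permutations_of_set {1..n}. card (inversions w) = k \<and> avoids w [1,3,2,4]}"
  define A where
    "A i = {u \<in> permutations_of_set {1..Suc i}. card (inversions u) = i \<and> avoids u [1,3,2]}" for i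
  define B where
    "B i = {v \<in> permutations_of_set {Suc i + 1..n}. card (inversions v) = k - i \<and> avoids v [2,1,3]}"
    for i
  have mem: "set u = {1..Suc i}" "set v = {Suc i + 1..n}" "length u = Suc i" "u \<noteq> []" "v \<noteq> []"
    "\<forall>x\<in>set u. \<forall>y\<in>set v. x < y" "card (inversions u) = i" "avoids u [1,3,2]"
    if "i \<le> k" "u \<in> A i" "v \<in> B i" for i u v
  proof -
    show u: "set u = {1..Suc i}"
      using that by (auto simp: A_def permutations_of_set_def)
    show v: "set v = {Suc i + 1..n}"
      using that by (auto simp: B_def permutations_of_set_def)
    have "u \<in> permutations_of_set {1..Suc i}" using that(2) by (simp add: A_def)
    then show "length u = Suc i" by (simp add: length_finite_permutations_of_set)
    show "u \<noteq> []" using u by auto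
    show "v \<noteq> []" using v that(1) assms by auto
    show "\<forall>x\<in>set u. \<forall>y\<in>set v. x < y" by (auto simp: u v)
    show "card (inversions u) = i" "avoids u [1,3,2]" using that(2) by (simp_all add: A_def)
  qed
  have "bij_betw (\<lambda>(i, u, v). u @ v) (SIGMA i:{0..k}. A i \<times> B i) S"
    unfolding bij_betw_def
  proof
    show "inj_on (\<lambda>(i, u, v). u @ v) (SIGMA i:{0..k}. A i \<times> B i)"
    proof (rule inj_onI)
      fix p q
      assume p: "p \<in> (SIGMA i:{0..k}. A i \<times> B i)" and q: "q \<in> (SIGMA i:{0..k}. A i \<times> B i)"
        and pq: "(\<lambda>(i, u, v). u @ v) p = (\<lambda>(i, u, v). u @ v) q"
      obtain i u v where p_eq: "p = (i, u, v)" and i: "i \<le> k" and uv: "u \<in> A i" "v \<in> B i"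
        using p by auto
      obtain j u' v' where q_eq: "q = (j, u', v')" and j: "j \<le> k"
        and uv': "u' \<in> A j" "v' \<in> B j"
        using q by auto
      have eq: "u @ v = u' @ v'" using pq by (simp add: p_eq q_eq)
      note m = mem[OF i uv] and m' = mem[OF j uv']
      \<comment> \<open>The prefixes have \<open>i\<close> and \<open>j\<close> inversions and
        lengths one larger, so for different indices the longer prefix would contain a 132.\<close>
      have "\<not> i < j"
        using not_avoids_132_of_longer_prefix[OF eq] m m' by auto
      moreover have "\<not> j < i"
        using not_avoids_132_of_longer_prefix[OF eq[symmetric]] m m' by auto
      ultimately have "i = j" by simp
      then show "p = q" using eq m(3) m'(3) by (simp add: p_eq q_eq)
    qed
    show "(\<lambda>(i, u, v). u @ v) ` (SIGMA i:{0..k}. A i \<times> B i) = S"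
    proof (intro equalityI subsetI)
      fix w assume "w \<in> (\<lambda>(i, u, v). u @ v) ` (SIGMA i:{0..k}. A i \<times> B i)"
      then obtain i u v where w: "w = u @ v" and i: "i \<le> k" and uv: "u \<in> A i" "v \<in> B i"
        by auto
      note m = mem[OF i uv]
      have "u @ v \<in> permutations_of_set ({1..Suc i} \<union> {Suc i + 1..n})"
        using uv by (intro append_in_permutations_of_set) (auto simp: A_def B_def)
      moreover have "{1..Suc i} \<union> {Suc i + 1..n} = {1..n}" using i assms by auto
      moreover have "card (inversions (u @ v)) = k"
        using card_inversions_append[of u v] m(6,7) uv(2) i by (auto simp: B_def less_imp_le)
      moreover have "avoids (u @ v) [1,3,2,4]"
        using avoids_1324_append_iff[OF m(6,4,5)] m(8) uv(2) unfolding B_def by blast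
      ultimately show "w \<in> S" by (simp add: S_def w)
    next
      fix w assume "w \<in> S"
      then have w: "w \<in> permutations_of_set {1..n}" "avoids w [1,3,2,4]" "card (inversions w) = k"
        by (auto simp: S_def)
      obtain u v where uv: "w = u @ v" "v \<noteq> []" "\<forall>x\<in>set u. \<forall>y\<in>set v. x < y"
        "length u = Suc (card (inversions u))"
        using split_1324_avoider[OF w(1,2)] w(3) assms by auto
      define i where "i = card (inversions u)"
      have sum: "k = i + card (inversions v)"
        using card_inversions_append[of u v] uv w(3) by (auto simp: i_def less_imp_le)
      have "u \<noteq> []" using uv(4) by auto
      then have "avoids u [1,3,2]" "avoids v [2,1,3]"
        using avoids_1324_append_iff[OF uv(3) _ uv(2)] w(2) uv(1) by auto
      moreover have "u \<in> permutations_of_set {1..Suc i}" "v \<in> permutations_of_set {Suc i + 1..n}"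
        using split_permutation[of u v n] uv w(1) by (simp_all add: i_def)
      ultimately have "u \<in> A i" "v \<in> B i" "i \<le> k"
        using sum by (simp_all add: A_def B_def i_def)
      then show "w \<in> (\<lambda>(i, u, v). u @ v) ` (SIGMA i:{0..k}. A i \<times> B i)"
        by (intro image_eqI[of _ _ "(i, u, v)"]) (auto simp: uv(1))
    qed
  qed
  then have "card S = card (SIGMA i:{0..k}. A i \<times> B i)"
    by (simp add: bij_betw_same_card)
  also have "\<dots> = (\<Sum>i=0..k. card (A i \<times> B i))"
    by (rule card_SigmaI) (auto simp: A_def B_def)
  also have "\<dots> = (\<Sum>i=0..k. num_partitions i * num_partitions (k - i))"
  proof (rule sum.cong)
    fix i assume i: "i \<in> {0..k}"
    have "card (A i) = num_partitions i"
      unfolding A_def by (rule card_avoiding_132) auto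
    \<comment> \<open>The interval has \<open>n - i - 1\<close> elements, which is more than
      \<open>k - i\<close> because \<open>k + 2 \<le> n\<close>.\<close>
    moreover have "card (B i) = num_partitions (k - i)"
      unfolding B_def by (rule card_avoiding_213) (use i assms in auto)
    ultimately show "card (A i \<times> B i) = num_partitions i * num_partitions (k - i)"
      by (simp add: card_cartesian_product)
  qed simp
  finally show ?thesis by (simp add: av_def S_def)
qed

section \<open>Adding the pattern 2413 and passing to the limit\<close>

lemma avoids_2413_of_avoids_1324:
  assumes w: "w \<in> permutations_of_set {1..n}" "avoids w [1,3,2,4]"
    and inv: "card (inversions w) + 2 \<le> n"
  shows "avoids w [2,4,1,3]"
proof -
  obtain u v where uv: "w = u @ v" "v \<noteq> []" "\<forall>x\<in>set u. \<forall>y\<in>set v. x < y"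
    "length u = Suc (card (inversions u))"
    using split_1324_avoider[OF assms] .
  then have "u \<noteq> []" by auto
  then have "avoids u [1,3,2] \<and> avoids v [2,1,3]"
    using avoids_1324_append_iff[OF uv(3) _ uv(2)] w(2) uv(1) by blast
  then show ?thesis unfolding uv(1) using avoids_2413_append[OF uv(3)] by blast
qed

theorem proposition5p12:
  shows "(\<forall>k n :: nat. n \<ge> k + 2 \<longrightarrow>
            av n k {[1,3,2,4], [2,4,1,3]} = av n k {[1,3,2,4]} \<and>
            av n k {[1,3,2,4]} = (\<Sum>i=0..k. num_partitions i * num_partitions (k - i))) \<and>
         (\<exists>c. is_limit_sequence {[1,3,2,4], [2,4,1,3]} c) \<and>
         limit_gf {[1,3,2,4], [2,4,1,3]} = (Abs_fps num_partitions)\<^sup>2"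
proof -
  let ?B = "{[1,3,2,4], [2,4,1,3]} :: nat list set"
  define c where "c k = (\<Sum>i=0..k. num_partitions i * num_partitions (k - i))" for k
  have eq: "av n k ?B = av n k {[1,3,2,4]}" if "n \<ge> k + 2" for n k
  proof -
    have "{w \<in> permutations_of_set {1..n}. card (inversions w) = k \<and> (\<forall>q\<in>?B. avoids w q)} =
        {w \<in> permutations_of_set {1..n}. card (inversions w) = k \<and>
          (\<forall>q\<in>{[1,3,2,4]}. avoids w q)}"
      using avoids_2413_of_avoids_1324 that by blast
    then show ?thesis by (simp only: av_def)
  qed
  have count: "av n k {[1,3,2,4]} = c k" if "n \<ge> k + 2" for n k
    unfolding c_def using that by (rule card_avoiding_1324)
  have lim: "is_limit_sequence ?B c"
    unfolding is_limit_sequence_def using eq count by metis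
  \<comment> \<open>The description in \<open>limit_gf\<close> needs uniqueness: two limit sequences
    agree at \<open>k\<close> because both give the count for every sufficiently large
    \<open>n\<close>.\<close>
  have "d = c" if d: "is_limit_sequence ?B d" for d
  proof
    fix k
    obtain m m' where "\<forall>n\<ge>m. av n k ?B = d k" "\<forall>n\<ge>m'. av n k ?B = c k"
      using lim d unfolding is_limit_sequence_def by meson
    from this[rule_format, of "max m m'"] show "d k = c k" by simp
  qed
  with lim have "(THE c. is_limit_sequence ?B c) = c" by (rule the_equality)
  then have "limit_gf ?B = (Abs_fps num_partitions)\<^sup>2"
    unfolding limit_gf_def by (simp add: fps_eq_iff power2_eq_square fps_mult_nth c_def)
  with lim eq count show ?thesis unfolding c_def by blast
qed

end
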